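(* Let $\theta,\rho\in\mathbb{R}$ with $|\theta|<1$, $|\rho|<1$, let $(V_n)_{n\ge1}$ be a sequence of square-integrable, independent and identically distributed real random variables with zero mean and variance $\sigma^2>0$, let the initial values $X_0,\varepsilon_0$ be arbitrary, and for all $n\ge1$ let $X_n=\theta X_{n-1}+\varepsilon_n$ and $\varepsilon_n=\rho\varepsilon_{n-1}+V_n$. Let $\widehat{\rho}_n$ be the serial correlation estimator computed from the least squares residuals, as defined in the context. Then $$\lim_{n\to\infty}\widehat{\rho}_n=\rho^*\quad\text{almost surely},\qquad\text{where }\rho^*=\frac{\theta\rho(\theta+\rho)}{1+\theta\rho}.$$
   Context: For $n\ge1$ put $$\widehat{\theta}_n=\frac{\sum_{k=1}^n X_kX_{k-1}}{\sum_{k=1}^n X_{k-1}^2}.$$ At step $n$, the least squares residuals are $\widehat{\varepsilon}_0=X_0$ and $\widehat{\varepsilon}_k=X_k-\widehat{\theta}_nX_{k-1}$ for $1\le k\le n$ (they depend on $n$ through $\widehat\theta_n$). The serial correlation estimator is $$\widehat{\rho}_n=\frac{\sum_{k=1}^n\widehat{\varepsilon}_k\widehat{\varepsilon}_{k-1}}{\sum_{k=1}^n\widehat{\varepsilon}_{k-1}^{\,2}}.$$ Convention: a quotient defining an estimator is read as $0$ if its denominator vanishes. *)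

theory Defs
  imports "HOL-Probability.Probability"
begin

text \<open>
  The estimators are functionals of one observed path \<open>x 0, x 1, \<dots>\<close>.  The convention that a
  quotient with vanishing denominator is read as 0 is the one built into division on the reals.
\<close>

definition theta_hat :: "(nat \<Rightarrow> real) \<Rightarrow> nat \<Rightarrow> real" where
  "theta_hat x n = (\<Sum>k=1..n. x k * x (k - 1)) / (\<Sum>k=1..n. (x (k - 1))\<^sup>2)"

text \<open>The \<open>k\<close>-th residual at step \<open>n\<close>, meaningful for \<open>k \<le> n\<close>.\<close>

definition residual :: "(nat \<Rightarrow> real) \<Rightarrow> nat \<Rightarrow> nat \<Rightarrow> real" where
  "residual x n k = (if k = 0 then x 0 else x k - theta_hat x n * x (k - 1))"

definition rho_hat :: "(nat \<Rightarrow> real) \<Rightarrow> nat \<Rightarrow> real" where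
  "rho_hat x n =
    (\<Sum>k=1..n. residual x n k * residual x n (k - 1)) / (\<Sum>k=1..n. (residual x n (k - 1))\<^sup>2)"

end

theory Submission
  imports Defs "HOL-Library.Discrete_Functions"
begin

text \<open>
  Eliminating the errors \<open>\<epsilon>\<close> shows that \<open>X\<close> is a second-order autoregression with coefficients
  \<open>\<phi>1 = \<theta> + \<rho>\<close> and \<open>\<phi>2 = - \<theta> \<rho>\<close>, driven by \<open>V\<close>.  If the noise is asymptotically orthogonal
  to the past of \<open>X\<close> along the path, then the empirical autocorrelations at lags one and two obey
  the Yule--Walker equations in the limit, so they tend to \<open>r = \<phi>1 / (1 - \<phi>2)\<close> and \<open>\<phi>1 r + \<phi>2\<close>.
  Hence the least squares estimator tends to \<open>r\<close> rather than to \<open>\<theta>\<close>, and \<open>rho_hat\<close>, which is a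
  continuous function of these autocorrelations and of \<open>theta_hat\<close> up to boundary terms, tends to
  \<open>(r - r (\<phi>1 r + \<phi>2) - r + r\<^sup>3) / (1 - r\<^sup>2) = - \<phi>2 r\<close>.

  The argument is carried out for one fixed path, with every sum measured against the energy
  \<open>\<Sum>k\<le>n. (V k)\<^sup>2\<close> of the noise instead of against \<open>n\<close>.  As both estimators are ratios, nothing is
  lost, and a linear lower bound for the energy can replace its exact rate of growth; the bound
  follows from truncated squares, whereas \<open>(V k)\<^sup>2\<close> itself may have no second moment.

  The noise enters through three almost sure facts: its energy grows at least linearly
  (\<open>AE_energy_linear_growth\<close>), its lagged products average out to zero (\<open>AE_lag_sum_average\<close>), and
  \<open>(V n)\<^sup>2 = o(n)\<close> (\<open>AE_square_average\<close>).  The first two follow from a strong law for orthogonal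
  sequences with bounded second moments (\<open>orthogonal_sequence.strong_law\<close>), the third from the
  Borel--Cantelli lemma.

  The three facts say that the noise is \<open>predetermined\<close> with respect to itself.  This property
  survives one stable autoregressive filter (\<open>ar_step.predetermined_step\<close>); two filters lead from
  \<open>V\<close> to \<open>\<epsilon>\<close> to \<open>X\<close>.  The initial values \<open>X 0\<close> and \<open>\<epsilon> 0\<close> contribute only terms that are
  bounded along the path, whatever their law and their dependence on the noise.
\<close>

section \<open>Lagged sums\<close>

text \<open>
  The range starts beyond \<open>j\<close>, so that only entries with positive index occur: the noise starts at
  index \<open>1\<close>, and the entries of \<open>X\<close> and \<open>\<epsilon>\<close> at index \<open>0\<close> are arbitrary initial values.
\<close>

definition lag_sum :: "(nat \<Rightarrow> real) \<Rightarrow> (nat \<Rightarrow> real) \<Rightarrow> nat \<Rightarrow> nat \<Rightarrow> real" where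
  "lag_sum a b j n = (\<Sum>k\<in>{j<..n}. a k * b (k - j))"

abbreviation energy :: "(nat \<Rightarrow> real) \<Rightarrow> nat \<Rightarrow> real" where
  "energy a \<equiv> lag_sum a a 0"

lemma energy_eq: "energy a n = (\<Sum>k\<in>{0<..n}. (a k)\<^sup>2)"
  by (simp add: lag_sum_def power2_eq_square)

lemma energy_nonneg: "0 \<le> energy a n"
  by (simp add: energy_eq sum_nonneg)

lemma energy_mono: "m \<le> n \<Longrightarrow> energy a m \<le> energy a n"
  unfolding energy_eq by (rule sum_mono2) auto

lemma lag_sum_Suc:
  "lag_sum a b j (Suc n) = lag_sum a b j n + (if j \<le> n then a (Suc n) * b (Suc n - j) else 0)"
proof -
  have "{j<..Suc n} = (if j \<le> n then insert (Suc n) {j<..n} else {j<..n})" by auto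
  then show ?thesis by (simp add: lag_sum_def)
qed

lemma lag_sum_0 [simp]: "lag_sum a b j 0 = 0"
  by (simp add: lag_sum_def)

text \<open>
  The inequality of arithmetic and geometric means suffices; what matters is that the bound does
  not depend on the lag.
\<close>

lemma abs_lag_sum_le: "\<bar>lag_sum a b j n\<bar> \<le> (energy a n + energy b n) / 2"
proof -
  have "\<bar>lag_sum a b j n\<bar> \<le> (\<Sum>k\<in>{j<..n}. \<bar>a k * b (k - j)\<bar>)"
    unfolding lag_sum_def by (rule sum_abs)
  also have "\<dots> \<le> (\<Sum>k\<in>{j<..n}. ((a k)\<^sup>2 + (b (k - j))\<^sup>2) / 2)"
  proof (rule sum_mono)
    fix k
    show "\<bar>a k * b (k - j)\<bar> \<le> ((a k)\<^sup>2 + (b (k - j))\<^sup>2) / 2"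
      using sum_squares_bound[of "\<bar>a k\<bar>" "\<bar>b (k - j)\<bar>"] by (simp add: abs_mult)
  qed
  also have "\<dots> = ((\<Sum>k\<in>{j<..n}. (a k)\<^sup>2) + (\<Sum>k\<in>{j<..n}. (b (k - j))\<^sup>2)) / 2"
    by (simp add: sum.distrib sum_divide_distrib[symmetric])
  also have "(\<Sum>k\<in>{j<..n}. (b (k - j))\<^sup>2) = energy b (n - j)"
    unfolding energy_eq
    by (rule sum.reindex_bij_witness[of _ "\<lambda>i. i + j" "\<lambda>k. k - j"]) auto
  also have "\<dots> \<le> energy b n" by (rule energy_mono) simp
  also have "(\<Sum>k\<in>{j<..n}. (a k)\<^sup>2) \<le> energy a n"
    unfolding energy_eq by (rule sum_mono2) auto
  finally show ?thesis by simp
qed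

section \<open>Passing through a stable autoregressive filter\<close>

lemma contraction_tendsto_zero:
  fixes a b :: "nat \<Rightarrow> real"
  assumes r: "0 \<le> r" "r < 1" and nonneg: "\<And>n. 0 \<le> a n"
    and step: "\<forall>\<^sub>F n in sequentially. a (Suc n) \<le> r * a n + b n"
    and b: "b \<longlonglongrightarrow> 0"
  shows "a \<longlonglongrightarrow> 0"
proof (rule order_tendstoI)
  fix y :: real assume "y < 0"
  then show "\<forall>\<^sub>F n in sequentially. y < a n" by (intro always_eventually allI less_le_trans[OF _ nonneg])
next
  fix e :: real assume "0 < e"
  then have "0 < (1 - r) * (e / 2)" using r by simp
  then have "\<forall>\<^sub>F n in sequentially. b n < (1 - r) * (e / 2)" by (rule order_tendstoD[OF b])
  with step have "\<forall>\<^sub>F n in sequentially. a (Suc n) \<le> r * a n + b n \<and> b n < (1 - r) * (e / 2)"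
    by (rule eventually_conj)
  \<comment> \<open>The weight \<open>1 - r\<close> makes \<open>e / 2\<close> a fixed point of \<open>y \<mapsto> r y + (1 - r) e / 2\<close>.\<close>
  then obtain N where N: "\<And>n. n \<ge> N \<Longrightarrow> a (Suc n) \<le> r * a n + b n \<and> b n < (1 - r) * (e / 2)"
    by (auto simp: eventually_sequentially)
  have bound: "a (m + N) \<le> r ^ m * a N + e / 2" for m
  proof (induction m)
    case 0 then show ?case using \<open>0 < e\<close> by simp
  next
    case (Suc m)
    have "a (Suc m + N) \<le> r * a (m + N) + (1 - r) * (e / 2)" using N[of "m + N"] by simp
    also have "\<dots> \<le> r * (r ^ m * a N + e / 2) + (1 - r) * (e / 2)"
      using Suc r by (intro add_right_mono mult_left_mono) auto
    also have "\<dots> = r ^ Suc m * a N + e / 2" by (simp add: field_simps)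
    finally show ?case .
  qed
  have "(\<lambda>m. r ^ m * a N + e / 2) \<longlonglongrightarrow> 0 * a N + e / 2"
    using r by (intro tendsto_intros LIMSEQ_realpow_zero) auto
  then have "\<forall>\<^sub>F m in sequentially. r ^ m * a N + e / 2 < e"
    by (rule order_tendstoD(2)) (use \<open>0 < e\<close> in simp)
  then have "\<forall>\<^sub>F m in sequentially. a (m + N) < e"
    by eventually_elim (use bound in \<open>auto intro: le_less_trans\<close>)
  then show "\<forall>\<^sub>F n in sequentially. a n < e"
    by (rule eventually_sequentially_seg[THEN iffD1])
qed

text \<open>
  Relative to the energy of \<open>v\<close>, the path \<open>u\<close> has bounded energy, a negligible last term, and past
  values asymptotically uncorrelated with the current value of \<open>v\<close>.  The name follows the
  econometric term for a regressor uncorrelated with present and future noise.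
\<close>

definition predetermined :: "(nat \<Rightarrow> real) \<Rightarrow> (nat \<Rightarrow> real) \<Rightarrow> bool" where
  "predetermined v u \<longleftrightarrow>
    (\<exists>C. \<forall>\<^sub>F n in sequentially. energy u n \<le> C * energy v n) \<and>
    (\<lambda>n. (u n)\<^sup>2 / energy v n) \<longlonglongrightarrow> 0 \<and>
    (\<forall>j\<ge>1. (\<lambda>n. lag_sum v u j n / energy v n) \<longlonglongrightarrow> 0)"

locale ar_step =
  fixes r :: real and w u :: "nat \<Rightarrow> real"
  assumes stable: "\<bar>r\<bar> < 1"
    and step: "\<And>n. u (Suc n) = r * u n + w (Suc n)"
begin

text \<open>
  Convexity of the square: \<open>r u + w\<close> is in absolute value at most the convex combination of \<open>\<bar>u\<bar>\<close>
  and \<open>\<bar>w\<bar> / (1 - \<bar>r\<bar>)\<close> with weights \<open>\<bar>r\<bar>\<close> and \<open>1 - \<bar>r\<bar>\<close>.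
\<close>

lemma step_square: "(u (Suc n))\<^sup>2 \<le> \<bar>r\<bar> * (u n)\<^sup>2 + (w (Suc n))\<^sup>2 / (1 - \<bar>r\<bar>)"
proof -
  define s a b where "s = \<bar>r\<bar>" and "a = \<bar>u n\<bar>" and "b = \<bar>w (Suc n)\<bar>"
  have s: "0 \<le> s" "s < 1" using stable by (auto simp: s_def)
  define c where "c = b / (1 - s)"
  have b: "b = (1 - s) * c" using s by (simp add: c_def)
  have "\<bar>u (Suc n)\<bar> \<le> s * a + b"
    unfolding step s_def a_def b_def by (metis abs_mult abs_triangle_ineq)
  then have "(u (Suc n))\<^sup>2 \<le> (s * a + b)\<^sup>2"
    by (metis abs_ge_zero power2_abs power_mono)
  also have "\<dots> = s * a\<^sup>2 + (1 - s) * c\<^sup>2 - s * (1 - s) * (a - c)\<^sup>2"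
    unfolding b by (simp add: power2_eq_square algebra_simps)
  also have "\<dots> \<le> s * a\<^sup>2 + (1 - s) * c\<^sup>2" using s by simp
  also have "(1 - s) * c\<^sup>2 = b\<^sup>2 / (1 - s)"
    using s by (simp add: c_def power2_eq_square)
  finally show ?thesis by (simp add: s_def a_def b_def)
qed

lemma energy_le:
  "energy u n \<le> (\<bar>r\<bar> * (u 0)\<^sup>2 + energy w n / (1 - \<bar>r\<bar>)) / (1 - \<bar>r\<bar>)"
proof -
  \<comment> \<open>Each \<open>(u k)\<^sup>2\<close> with \<open>k < n\<close> feeds the next step; the last one does not and is kept on the left.\<close>
  have "energy u n + \<bar>r\<bar> * (u n)\<^sup>2 \<le> \<bar>r\<bar> * ((u 0)\<^sup>2 + energy u n) + energy w n / (1 - \<bar>r\<bar>)"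
  proof (induction n)
    case (Suc n)
    show ?case using Suc step_square[of n]
      by (simp add: lag_sum_Suc power2_eq_square algebra_simps add_divide_distrib)
  qed simp
  moreover have "0 \<le> \<bar>r\<bar> * (u n)\<^sup>2" by simp
  ultimately have "energy u n * (1 - \<bar>r\<bar>) \<le> \<bar>r\<bar> * (u 0)\<^sup>2 + energy w n / (1 - \<bar>r\<bar>)"
    by (simp only: algebra_simps)
  then show ?thesis using stable by (simp add: pos_le_divide_eq)
qed

text \<open>
  The converse estimate.  Applied twice, it bounds the energy of the noise by that of the
  observed path, so that quantities negligible against the former are negligible against the
  latter.
\<close>

lemma innovation_energy_le: "energy w n \<le> 4 * energy u n + 2 * (u 0)\<^sup>2"
proof -
  have "energy w n + 2 * (u n)\<^sup>2 \<le> 4 * energy u n + 2 * (u 0)\<^sup>2"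
  proof (induction n)
    case (Suc n)
    have "w (Suc n) = u (Suc n) - r * u n" by (simp add: step)
    then have "(w (Suc n))\<^sup>2 \<le> 2 * (u (Suc n))\<^sup>2 + 2 * (r * u n)\<^sup>2"
      using zero_le_power2[of "u (Suc n) + r * u n"] by (simp add: power2_sum power2_diff)
    also have "(r * u n)\<^sup>2 \<le> (u n)\<^sup>2"
      using stable by (simp add: power_mult_distrib mult_left_le_one_le abs_square_le_1)
    finally show ?case using Suc
      by (simp add: lag_sum_Suc power2_eq_square algebra_simps)
  qed simp
  then show ?thesis using zero_le_power2[of "u n"] by linarith
qed

lemma lag_sum_step:
  "lag_sum v u j n =
    r * lag_sum v u (Suc j) n + lag_sum v w j n + (if j < n then r * v (Suc j) * u 0 else 0)"
proof (cases "j < n")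
  case True
  have "lag_sum v u j n = (\<Sum>k\<in>{j<..n}. r * (v k * u (k - Suc j)) + v k * w (k - j))"
    unfolding lag_sum_def
  proof (rule sum.cong)
    fix k assume "k \<in> {j<..n}"
    then have "k - j = Suc (k - Suc j)" by auto
    then show "v k * u (k - j) = r * (v k * u (k - Suc j)) + v k * w (k - j)"
      using step[of "k - Suc j"] by (simp add: algebra_simps)
  qed simp
  also have "\<dots> = r * (\<Sum>k\<in>{j<..n}. v k * u (k - Suc j)) + lag_sum v w j n"
    by (simp add: sum.distrib sum_distrib_left lag_sum_def)
  also have "{j<..n} = insert (Suc j) {Suc j<..n}" using True by auto
  finally show ?thesis using True by (simp add: lag_sum_def algebra_simps)
qed (simp add: lag_sum_def)

text \<open>
  The orthogonality to the past is the delicate part.  By \<open>lag_sum_step\<close> the normalised lagged sums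
  \<open>g j\<close> satisfy \<open>g j = r g (j + 1) + o(1)\<close>, hence \<open>g j = r\<^sup>m g (j + m) + o(1)\<close> for every fixed \<open>m\<close>.  Since
  the \<open>g j\<close> are bounded uniformly in \<open>j\<close>, letting \<open>m\<close> grow gives \<open>g j = o(1)\<close>.
\<close>

proposition predetermined_step:
  assumes w: "predetermined v w" and q: "filterlim (energy v) at_top sequentially"
  shows "predetermined v u"
proof -
  define s where "s = \<bar>r\<bar>"
  have s: "0 \<le> s" "s < 1" using stable by (auto simp: s_def)
  have pos: "\<forall>\<^sub>F n in sequentially. 1 \<le> energy v n"
    using q by (simp add: filterlim_at_top)
  have const: "(\<lambda>n. c / energy v n) \<longlonglongrightarrow> 0" for c
    by (rule tendsto_divide_0[OF tendsto_const]) (use q filterlim_at_top_imp_at_infinity in blast)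
  obtain C where C: "\<forall>\<^sub>F n in sequentially. energy w n \<le> C * energy v n"
    using w by (auto simp: predetermined_def)
  define K where "K = (s * (u 0)\<^sup>2 + C / (1 - s)) / (1 - s)"
  have K: "\<forall>\<^sub>F n in sequentially. energy u n \<le> K * energy v n"
    using C pos
  proof eventually_elim
    case (elim n)
    have "energy u n \<le> (s * (u 0)\<^sup>2 + energy w n / (1 - s)) / (1 - s)"
      unfolding s_def by (rule energy_le)
    also have "\<dots> \<le> (s * (u 0)\<^sup>2 * energy v n + C * energy v n / (1 - s)) / (1 - s)"
    proof (intro divide_right_mono add_mono)
      show "s * (u 0)\<^sup>2 \<le> s * (u 0)\<^sup>2 * energy v n"
        using s elim mult_left_mono[of 1 "energy v n" "s * (u 0)\<^sup>2"] by simp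
    qed (use s elim in auto)
    finally show ?case by (simp add: K_def distrib_left add_divide_distrib mult_ac)
  qed
  have last: "(\<lambda>n. (u n)\<^sup>2 / energy v n) \<longlonglongrightarrow> 0"
  proof (rule contraction_tendsto_zero[OF s])
    show "0 \<le> (u n)\<^sup>2 / energy v n" for n by (simp add: energy_nonneg)
    have "(\<lambda>n. (w n)\<^sup>2 / energy v n / (1 - s)) \<longlonglongrightarrow> 0 / (1 - s)"
      using w s by (intro tendsto_divide tendsto_const) (auto simp: predetermined_def)
    then show "(\<lambda>n. (w (Suc n))\<^sup>2 / energy v (Suc n) / (1 - s)) \<longlonglongrightarrow> 0"
      using LIMSEQ_Suc by fastforce
    show "\<forall>\<^sub>F n in sequentially. (u (Suc n))\<^sup>2 / energy v (Suc n)
        \<le> s * ((u n)\<^sup>2 / energy v n) + (w (Suc n))\<^sup>2 / energy v (Suc n) / (1 - s)"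
      using pos
    proof eventually_elim
      case (elim n)
      have qn: "energy v n \<le> energy v (Suc n)" by (rule energy_mono) simp
      have "(u (Suc n))\<^sup>2 / energy v (Suc n)
          \<le> (s * (u n)\<^sup>2 + (w (Suc n))\<^sup>2 / (1 - s)) / energy v (Suc n)"
        unfolding s_def by (intro divide_right_mono step_square energy_nonneg)
      also have "\<dots> = s * (u n)\<^sup>2 / energy v (Suc n) + (w (Suc n))\<^sup>2 / energy v (Suc n) / (1 - s)"
        by (simp add: add_divide_distrib mult.commute)
      also have "s * (u n)\<^sup>2 / energy v (Suc n) \<le> s * (u n)\<^sup>2 / energy v n"
        using qn elim s by (intro divide_left_mono mult_nonneg_nonneg mult_pos_pos) auto
      finally show ?case by simp
    qed
  qed
  have lag: "(\<lambda>n. lag_sum v u j n / energy v n) \<longlonglongrightarrow> 0" if j: "1 \<le> j" for j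
  proof -
    define g where "g i n = lag_sum v u i n / energy v n" for i n
    have rec: "(\<lambda>n. g i n - r * g (Suc i) n) \<longlonglongrightarrow> 0" if "1 \<le> i" for i
    proof -
      have "(\<lambda>n. lag_sum v w i n / energy v n + r * v (Suc i) * u 0 / energy v n) \<longlonglongrightarrow> 0 + 0"
        using w that by (intro tendsto_add const) (auto simp: predetermined_def)
      moreover have "\<forall>\<^sub>F n in sequentially. lag_sum v w i n / energy v n + r * v (Suc i) * u 0 / energy v n
          = g i n - r * g (Suc i) n"
        using eventually_gt_at_top[of i]
        by eventually_elim (subst g_def, subst lag_sum_step, simp add: g_def add_divide_distrib)
      ultimately show ?thesis by (simp add: tendsto_cong)
    qed
    have iter: "(\<lambda>n. g j n - r ^ m * g (j + m) n) \<longlonglongrightarrow> 0" for m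
    proof (induction m)
      case (Suc m)
      have "(\<lambda>n. (g j n - r ^ m * g (j + m) n) + r ^ m * (g (j + m) n - r * g (Suc (j + m)) n))
          \<longlonglongrightarrow> 0 + r ^ m * 0"
        using j by (intro tendsto_intros Suc rec) auto
      then show ?case by (simp add: algebra_simps)
    qed simp
    have bound: "\<forall>\<^sub>F n in sequentially. \<forall>i. \<bar>g i n\<bar> \<le> (1 + \<bar>K\<bar>) / 2"
      using K pos
    proof eventually_elim
      case (elim n)
      show ?case
      proof
        fix i
        have "\<bar>lag_sum v u i n\<bar> \<le> (energy v n + energy u n) / 2" by (rule abs_lag_sum_le)
        also have "\<dots> \<le> (energy v n + \<bar>K\<bar> * energy v n) / 2"
          using order_trans[OF elim(1) mult_right_mono[OF abs_ge_self energy_nonneg]] by simp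
        finally show "\<bar>g i n\<bar> \<le> (1 + \<bar>K\<bar>) / 2"
          using elim by (simp add: g_def abs_divide field_simps)
      qed
    qed
    have "g j \<longlonglongrightarrow> 0"
    proof (rule tendstoI)
      fix e :: real assume e: "0 < e"
      have "(\<lambda>m. s ^ m * ((1 + \<bar>K\<bar>) / 2)) \<longlonglongrightarrow> 0 * ((1 + \<bar>K\<bar>) / 2)"
        using s by (intro tendsto_intros LIMSEQ_realpow_zero) auto
      then have "\<forall>\<^sub>F m in sequentially. s ^ m * ((1 + \<bar>K\<bar>) / 2) < e / 2"
        by (rule order_tendstoD(2)) (use e in simp)
      then obtain m where m: "s ^ m * ((1 + \<bar>K\<bar>) / 2) < e / 2"
        using eventually_happens'[OF sequentially_bot] by metis
      have "\<forall>\<^sub>F n in sequentially. dist (g j n - r ^ m * g (j + m) n) 0 < e / 2"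
        using e by (intro tendstoD[OF iter]) auto
      then show "\<forall>\<^sub>F n in sequentially. dist (g j n) 0 < e"
        using bound
      proof eventually_elim
        case (elim n)
        have "\<bar>r ^ m * g (j + m) n\<bar> \<le> s ^ m * ((1 + \<bar>K\<bar>) / 2)"
          unfolding abs_mult power_abs s_def using elim by (intro mult_left_mono) auto
        with elim(1) m show ?case unfolding dist_real_def diff_0_right by linarith
      qed
    qed
    then show ?thesis by (simp add: g_def[abs_def])
  qed
  show ?thesis unfolding predetermined_def using K last lag by blast
qed

end

section \<open>Yule--Walker equations and the limit of the estimator\<close>

text \<open>
  The equations arise from multiplying the recursion by \<open>x (k - 1)\<close> and \<open>x (k - 2)\<close> and summing.
  They are kept exact, with all boundary terms, so that they follow by induction on \<open>n\<close>.
\<close>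

lemma yule_walker_lag_sums:
  fixes x v :: "nat \<Rightarrow> real"
  assumes ar2: "\<And>k. x (Suc (Suc k)) = a * x (Suc k) + b * x k + v (Suc (Suc k))"
    and n: "2 \<le> n"
  shows "lag_sum x x 1 n = a * (energy x n - (x n)\<^sup>2)
      + b * (x 1 * x 0 + lag_sum x x 1 n - x n * x (n - 1)) + lag_sum v x 1 n" (is ?A)
    and "lag_sum x x 2 n = a * (lag_sum x x 1 n - x n * x (n - 1))
      + b * (energy x n - (x n)\<^sup>2 - (x (n - 1))\<^sup>2) + lag_sum v x 2 n" (is ?B)
proof -
  have x2: "x 2 = a * x 1 + b * x 0 + v 2"
    using ar2[of 0] by (simp add: numeral_2_eq_2)
  have "?A \<and> ?B"
    using n
  proof (induction n rule: dec_induct)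
    case base
    show ?case
      by (simp add: lag_sum_Suc numeral_2_eq_2) (simp add: x2[unfolded numeral_2_eq_2] algebra_simps power2_eq_square)
  next
    case (step n)
    then obtain m where m: "n = Suc (Suc m)" by (metis add_2_eq_Suc le_Suc_ex)
    define z where "z = x (Suc n)"
    have z: "z = a * x n + b * x (n - 1) + v (Suc n)"
      using ar2[of "Suc m"] by (simp add: z_def m)
    have upd: "lag_sum x x 1 (Suc n) = lag_sum x x 1 n + z * x n"
      "lag_sum v x 1 (Suc n) = lag_sum v x 1 n + v (Suc n) * x n"
      "lag_sum x x 2 (Suc n) = lag_sum x x 2 n + z * x (n - 1)"
      "lag_sum v x 2 (Suc n) = lag_sum v x 2 n + v (Suc n) * x (n - 1)"
      "energy x (Suc n) = energy x n + z\<^sup>2"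
      by (simp_all add: lag_sum_Suc z_def m power2_eq_square)
    show ?case
      unfolding upd diff_Suc_1 z_def[symmetric]
      using step.IH[THEN conjunct1] step.IH[THEN conjunct2] z
      unfolding power2_eq_square by (intro conjI; algebra)
  qed
  then show ?A ?B by auto
qed

lemma theta_hat_eq:
  assumes "1 \<le> n"
  shows "theta_hat x n = (lag_sum x x 1 n + x 1 * x 0) / (energy x n - (x n)\<^sup>2 + (x 0)\<^sup>2)"
proof -
  have "(\<Sum>k=1..n. x k * x (k - 1)) = lag_sum x x 1 n + x 1 * x 0
      \<and> (\<Sum>k=1..n. (x (k - 1))\<^sup>2) = energy x n - (x n)\<^sup>2 + (x 0)\<^sup>2"
    using assms by (induction n rule: dec_induct) (auto simp: lag_sum_Suc power2_eq_square)
  then show ?thesis by (simp add: theta_hat_def)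
qed

text \<open>
  The coefficient \<open>t\<close> stands for \<open>theta_hat x n\<close>, which changes with \<open>n\<close>; holding it fixed
  makes induction on the length of the sums possible.
\<close>

lemma residual_lag_sums:
  fixes x :: "nat \<Rightarrow> real" and t :: real
  defines "e \<equiv> \<lambda>k. if k = 0 then x 0 else x k - t * x (k - 1)"
  assumes n: "2 \<le> n"
  shows "(\<Sum>k=1..n. e k * e (k - 1)) = (x 1 - t * x 0) * x 0
      + lag_sum x x 1 n - t * (lag_sum x x 2 n + x 2 * x 0) - t * (energy x n - (x n)\<^sup>2)
      + t\<^sup>2 * (lag_sum x x 1 n + x 1 * x 0 - x n * x (n - 1))" (is ?A)
    and "(\<Sum>k=1..n. (e (k - 1))\<^sup>2) = (x 0)\<^sup>2 + (energy x n - (x n)\<^sup>2)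
      - 2 * t * (lag_sum x x 1 n + x 1 * x 0 - x n * x (n - 1))
      + t\<^sup>2 * (energy x n - (x n)\<^sup>2 - (x (n - 1))\<^sup>2 + (x 0)\<^sup>2)" (is ?B)
proof -
  have "?A \<and> ?B"
    using n
  proof (induction n rule: dec_induct)
    case base
    show ?case by (simp add: lag_sum_Suc numeral_2_eq_2 e_def algebra_simps power2_eq_square)
  next
    case (step n)
    then obtain m where m: "n = Suc (Suc m)" by (metis add_2_eq_Suc le_Suc_ex)
    have sums: "(\<Sum>k=1..Suc n. e k * e (k - 1)) = (\<Sum>k=1..n. e k * e (k - 1))
        + (x (Suc n) - t * x n) * (x n - t * x (n - 1))"
      "(\<Sum>k=1..Suc n. (e (k - 1))\<^sup>2) = (\<Sum>k=1..n. (e (k - 1))\<^sup>2) + (x n - t * x (n - 1))\<^sup>2"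
      by (simp_all add: e_def m)
    have lags: "lag_sum x x 1 (Suc n) = lag_sum x x 1 n + x (Suc n) * x n"
      "lag_sum x x 2 (Suc n) = lag_sum x x 2 n + x (Suc n) * x (n - 1)"
      "energy x (Suc n) = energy x n + (x (Suc n))\<^sup>2"
      by (simp_all add: lag_sum_Suc m power2_eq_square)
    show ?case
      unfolding sums lags diff_Suc_1 step.IH[THEN conjunct1] step.IH[THEN conjunct2]
      by (simp add: algebra_simps power2_eq_square)
  qed
  then show ?A ?B by auto
qed

text \<open>
  All sums are divided by the energy \<open>D\<close> of the observed path, against which boundary terms and
  correlations with the noise vanish.  Stability enters a second time through
  \<open>(1 \<plusminus> \<theta>) (1 \<plusminus> \<rho>) > 0\<close>, which says \<open>\<bar>r\<bar> < 1\<close>, so that the limit \<open>1 - r\<^sup>2\<close> of the denominator of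
  \<open>rho_hat\<close> is not zero.
\<close>

theorem rho_hat_tendsto:
  fixes v \<epsilon> x :: "nat \<Rightarrow> real"
  assumes \<theta>: "\<bar>\<theta>\<bar> < 1" and \<rho>: "\<bar>\<rho>\<bar> < 1"
    and x: "\<And>k. x (Suc k) = \<theta> * x k + \<epsilon> (Suc k)"
    and \<epsilon>: "\<And>k. \<epsilon> (Suc k) = \<rho> * \<epsilon> k + v (Suc k)"
    and v: "predetermined v v" and q: "filterlim (energy v) at_top sequentially"
  shows "rho_hat x \<longlonglongrightarrow> \<theta> * \<rho> * (\<theta> + \<rho>) / (1 + \<theta> * \<rho>)"
proof -
  interpret x: ar_step \<theta> \<epsilon> x using \<theta> x by unfold_locales
  interpret \<epsilon>: ar_step \<rho> v \<epsilon> using \<rho> \<epsilon> by unfold_locales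
  have vx: "predetermined v x"
    by (rule x.predetermined_step[OF \<epsilon>.predetermined_step[OF v q] q])
  define D L1 L2 where "D = energy x" and "L1 = lag_sum x x 1" and "L2 = lag_sum x x 2"
  define c where "c = 8 * (x 0)\<^sup>2 + 2 * (\<epsilon> 0)\<^sup>2"
  have qD: "\<forall>\<^sub>F n in sequentially. 1 \<le> energy v n \<and> energy v n \<le> 32 * D n"
  proof -
    \<comment> \<open>Once the energy exceeds \<open>2 c\<close>, the constant in \<open>energy v n \<le> 16 D n + c\<close> is absorbed into the left side.\<close>
    have "\<forall>\<^sub>F n in sequentially. max 1 (2 * c) \<le> energy v n"
      using q unfolding filterlim_at_top by blast
    then show ?thesis
    proof eventually_elim
      case (elim n)
      have "energy v n \<le> 4 * energy \<epsilon> n + 2 * (\<epsilon> 0)\<^sup>2" by (rule \<epsilon>.innovation_energy_le)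
      also have "energy \<epsilon> n \<le> 4 * D n + 2 * (x 0)\<^sup>2"
        unfolding D_def by (rule x.innovation_energy_le)
      finally have "energy v n \<le> 16 * D n + c" by (simp add: c_def)
      with elim show ?case by simp
    qed
  qed
  have negligible: "(\<lambda>n. f n / D n) \<longlonglongrightarrow> 0" if "(\<lambda>n. f n / energy v n) \<longlonglongrightarrow> 0" for f
  proof (rule Lim_null_comparison)
    show "(\<lambda>n. 32 * \<bar>f n / energy v n\<bar>) \<longlonglongrightarrow> 0"
      using that by (intro tendsto_mult_right_zero tendsto_rabs_zero)
    show "\<forall>\<^sub>F n in sequentially. norm (f n / D n) \<le> 32 * \<bar>f n / energy v n\<bar>"
      using qD
    proof eventually_elim
      case (elim n)
      have "\<bar>f n\<bar> / D n \<le> \<bar>f n\<bar> / (energy v n / 32)"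
        using elim by (intro divide_left_mono) auto
      then show ?case using elim by (simp add: abs_divide mult.commute)
    qed
  qed
  have const: "(\<lambda>n. a / D n) \<longlonglongrightarrow> 0" for a
    by (intro negligible tendsto_divide_0[OF tendsto_const])
      (use q filterlim_at_top_imp_at_infinity in blast)
  have last: "(\<lambda>n. (x n)\<^sup>2 / D n) \<longlonglongrightarrow> 0"
    using vx by (intro negligible) (simp add: predetermined_def)
  have noise: "(\<lambda>n. lag_sum v x j n / D n) \<longlonglongrightarrow> 0" if "1 \<le> j" for j
    using vx that by (intro negligible) (simp add: predetermined_def)
  have D1: "\<forall>\<^sub>F n in sequentially. 0 < D n"
    using qD by eventually_elim linarith
  have prev: "(\<lambda>n. (x (n - 1))\<^sup>2 / D n) \<longlonglongrightarrow> 0"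
  proof (rule LIMSEQ_imp_Suc, simp, rule tendsto_sandwich[OF _ _ tendsto_const last])
    show "\<forall>\<^sub>F n in sequentially. (x n)\<^sup>2 / D (Suc n) \<le> (x n)\<^sup>2 / D n"
      using D1
    proof eventually_elim
      case (elim n)
      then show ?case
        using energy_mono[of n "Suc n" x] by (intro divide_left_mono) (auto simp: D_def)
    qed
    show "\<forall>\<^sub>F n in sequentially. 0 \<le> (x n)\<^sup>2 / D (Suc n)"
      by (simp add: D_def energy_nonneg)
  qed
  have cross: "(\<lambda>n. x n * x (n - 1) / D n) \<longlonglongrightarrow> 0"
  proof (rule Lim_null_comparison)
    show "(\<lambda>n. (x n)\<^sup>2 / D n + (x (n - 1))\<^sup>2 / D n) \<longlonglongrightarrow> 0"
      using tendsto_add[OF last prev] by simp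
    show "\<forall>\<^sub>F n in sequentially. norm (x n * x (n - 1) / D n)
        \<le> (x n)\<^sup>2 / D n + (x (n - 1))\<^sup>2 / D n"
      using D1
    proof eventually_elim
      case (elim n)
      have "\<bar>x n * x (n - 1)\<bar> \<le> (x n)\<^sup>2 + (x (n - 1))\<^sup>2"
        using sum_squares_bound[of "\<bar>x n\<bar>" "\<bar>x (n - 1)\<bar>"] abs_ge_zero[of "x n * x (n - 1)"]
        unfolding abs_mult mult.assoc power2_abs by linarith
      then show ?case
        using elim by (simp add: abs_divide add_divide_distrib[symmetric] divide_right_mono)
    qed
  qed
  define \<phi>1 \<phi>2 where "\<phi>1 = \<theta> + \<rho>" and "\<phi>2 = - (\<theta> * \<rho>)"
  have ar2: "x (Suc (Suc k)) = \<phi>1 * x (Suc k) + \<phi>2 * x k + v (Suc (Suc k))" for k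
    using x[of k] x[of "Suc k"] \<epsilon>[of "Suc k"] by (simp add: \<phi>1_def \<phi>2_def algebra_simps)
  note yw = yule_walker_lag_sums[where x = x and v = v, OF ar2, folded D_def L1_def L2_def]
  define r where "r = \<phi>1 / (1 - \<phi>2)"
  have "\<bar>\<theta> * \<rho>\<bar> < 1 * 1"
    unfolding abs_mult using \<theta> \<rho> by (intro mult_strict_mono') auto
  then have pos: "0 < 1 - \<phi>2" by (simp add: \<phi>2_def)
  have r: "r * (1 - \<phi>2) = \<phi>1" using pos by (simp add: r_def)
  have r1: "r\<^sup>2 < 1"
  proof -
    have "0 < (1 - \<theta>) * (1 - \<rho>)" "0 < (1 + \<theta>) * (1 + \<rho>)" using \<theta> \<rho> by auto
    then have "\<bar>\<phi>1\<bar> < 1 - \<phi>2" by (auto simp: \<phi>1_def \<phi>2_def algebra_simps)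
    then have "\<bar>r\<bar> < 1" using pos by (simp add: r_def abs_divide)
    then show ?thesis by (simp add: abs_square_less_1)
  qed
  have L1: "(\<lambda>n. L1 n / D n) \<longlonglongrightarrow> r"
  proof -
    have "(\<lambda>n. (\<phi>1 * (1 - (x n)\<^sup>2 / D n) + \<phi>2 * (x 1 * x 0 / D n - x n * x (n - 1) / D n)
        + lag_sum v x 1 n / D n) / (1 - \<phi>2)) \<longlonglongrightarrow> (\<phi>1 * (1 - 0) + \<phi>2 * (0 - 0) + 0) / (1 - \<phi>2)"
      using pos by (intro tendsto_intros last cross noise const) auto
    moreover have "\<forall>\<^sub>F n in sequentially.
        (\<phi>1 * (1 - (x n)\<^sup>2 / D n) + \<phi>2 * (x 1 * x 0 / D n - x n * x (n - 1) / D n)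
        + lag_sum v x 1 n / D n) / (1 - \<phi>2) = L1 n / D n"
      using D1 eventually_ge_at_top[of 2]
    proof eventually_elim
      case (elim n)
      have "(1 - \<phi>2) * L1 n = \<phi>1 * (D n - (x n)\<^sup>2) + \<phi>2 * (x 1 * x 0 - x n * x (n - 1)) + lag_sum v x 1 n"
        using yw(1)[OF elim(2)] by (simp add: algebra_simps)
      then have "(1 - \<phi>2) * L1 n / D n = (\<phi>1 * (D n - (x n)\<^sup>2)
          + \<phi>2 * (x 1 * x 0 - x n * x (n - 1)) + lag_sum v x 1 n) / D n"
        by simp
      also have "\<dots> = \<phi>1 * (1 - (x n)\<^sup>2 / D n) + \<phi>2 * (x 1 * x 0 / D n - x n * x (n - 1) / D n)
        + lag_sum v x 1 n / D n"
        using elim by (simp add: field_simps)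
      finally show ?case using pos by (simp add: field_simps)
    qed
    ultimately show ?thesis by (simp add: tendsto_cong r_def)
  qed
  have L2: "(\<lambda>n. L2 n / D n) \<longlonglongrightarrow> \<phi>1 * r + \<phi>2"
  proof -
    have "(\<lambda>n. \<phi>1 * (L1 n / D n - x n * x (n - 1) / D n)
        + \<phi>2 * (1 - (x n)\<^sup>2 / D n - (x (n - 1))\<^sup>2 / D n) + lag_sum v x 2 n / D n)
        \<longlonglongrightarrow> \<phi>1 * (r - 0) + \<phi>2 * (1 - 0 - 0) + 0"
      by (intro tendsto_intros L1 last prev cross noise) auto
    moreover have "\<forall>\<^sub>F n in sequentially. \<phi>1 * (L1 n / D n - x n * x (n - 1) / D n)
        + \<phi>2 * (1 - (x n)\<^sup>2 / D n - (x (n - 1))\<^sup>2 / D n) + lag_sum v x 2 n / D n = L2 n / D n"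
      using D1 eventually_ge_at_top[of 2]
      by eventually_elim (simp add: yw(2) field_simps)
    ultimately show ?thesis by (simp add: tendsto_cong)
  qed
  define t where "t = theta_hat x"
  have t: "t \<longlonglongrightarrow> r"
  proof -
    have "(\<lambda>n. (L1 n / D n + x 1 * x 0 / D n) / (1 - (x n)\<^sup>2 / D n + (x 0)\<^sup>2 / D n))
        \<longlonglongrightarrow> (r + 0) / (1 - 0 + 0)"
      by (intro tendsto_intros L1 last const) auto
    moreover have "\<forall>\<^sub>F n in sequentially.
        (L1 n / D n + x 1 * x 0 / D n) / (1 - (x n)\<^sup>2 / D n + (x 0)\<^sup>2 / D n) = t n"
      using D1 eventually_ge_at_top[of 1]
    proof eventually_elim
      case (elim n)
      then have "1 - (x n)\<^sup>2 / D n + (x 0)\<^sup>2 / D n = (D n - (x n)\<^sup>2 + (x 0)\<^sup>2) / D n"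
        by (simp add: field_simps)
      then show ?case
        using elim by (simp add: t_def theta_hat_eq D_def L1_def add_divide_distrib[symmetric])
    qed
    ultimately show ?thesis by (simp add: tendsto_cong)
  qed
  \<comment> \<open>\<open>P\<close> and \<open>Q\<close> are the numerator and the denominator of \<open>rho_hat\<close>, divided by \<open>D\<close>.\<close>
  define P Q where
    "P n = (x 1 - t n * x 0) * (x 0 / D n) + L1 n / D n - t n * (L2 n / D n + x 2 * x 0 / D n)
      - t n * (1 - (x n)\<^sup>2 / D n)
      + (t n)\<^sup>2 * (L1 n / D n + x 1 * x 0 / D n - x n * x (n - 1) / D n)" and
    "Q n = (x 0)\<^sup>2 / D n + (1 - (x n)\<^sup>2 / D n)
      - 2 * t n * (L1 n / D n + x 1 * x 0 / D n - x n * x (n - 1) / D n)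
      + (t n)\<^sup>2 * (1 - (x n)\<^sup>2 / D n - (x (n - 1))\<^sup>2 / D n + (x 0)\<^sup>2 / D n)" for n
  have "P \<longlonglongrightarrow>
      (x 1 - r * x 0) * 0 + r - r * ((\<phi>1 * r + \<phi>2) + 0) - r * (1 - 0) + r\<^sup>2 * (r + 0 - 0)"
    unfolding P_def by (intro tendsto_intros t L1 L2 last cross const)
  \<comment> \<open>By \<open>\<phi>1 = r (1 - \<phi>2)\<close>, the factor \<open>1 - r\<^sup>2\<close> splits off and cancels in the quotient.\<close>
  moreover have "(x 1 - r * x 0) * 0 + r - r * ((\<phi>1 * r + \<phi>2) + 0) - r * (1 - 0) + r\<^sup>2 * (r + 0 - 0)
      = - \<phi>2 * r * (1 - r\<^sup>2)"
    unfolding r[symmetric] by (simp add: algebra_simps power2_eq_square)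
  ultimately have P: "P \<longlonglongrightarrow> - \<phi>2 * r * (1 - r\<^sup>2)" by simp
  have "Q \<longlonglongrightarrow> 0 + (1 - 0) - 2 * r * (r + 0 - 0) + r\<^sup>2 * (1 - 0 - 0 + 0)"
    unfolding Q_def by (intro tendsto_intros t L1 last prev cross const)
  then have Q: "Q \<longlonglongrightarrow> 1 - r\<^sup>2" by (simp add: power2_eq_square)
  have "\<forall>\<^sub>F n in sequentially. P n / Q n = rho_hat x n"
    using D1 eventually_ge_at_top[of 2]
  proof eventually_elim
    case (elim n)
    note sums = residual_lag_sums[OF elim(2), of x "t n", folded D_def L1_def L2_def]
    have "rho_hat x n = (P n * D n) / (Q n * D n)"
      unfolding rho_hat_def residual_def t_def[symmetric] sums
      using elim by (intro arg_cong2[where f = "(/)"]) (simp_all add: P_def Q_def field_simps)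
    then show ?case using elim by simp
  qed
  moreover have "(\<lambda>n. P n / Q n) \<longlonglongrightarrow> - \<phi>2 * r"
    using tendsto_divide[OF P Q] r1 by simp
  ultimately have "rho_hat x \<longlonglongrightarrow> - \<phi>2 * r"
    by (simp add: tendsto_cong)
  then show ?thesis by (simp add: r_def \<phi>1_def \<phi>2_def)
qed


section \<open>A strong law for orthogonal sequences\<close>

lemma (in prob_space) AE_tendsto_zero_of_summable_expectation:
  fixes f :: "nat \<Rightarrow> 'a \<Rightarrow> real"
  assumes int: "\<And>m. integrable M (f m)" and nonneg: "\<And>m \<omega>. 0 \<le> f m \<omega>"
    and bound: "\<And>m. expectation (f m) \<le> b m" and b: "summable b"
  shows "AE \<omega> in M. (\<lambda>m. f m \<omega>) \<longlonglongrightarrow> 0"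
proof -
  have sb: "summable (\<lambda>m. expectation (f m))"
    by (rule summable_comparison_test'[OF b, of 0]) (simp add: bound nonneg)
  have "(\<integral>\<^sup>+\<omega>. (\<Sum>m. ennreal (f m \<omega>)) \<partial>M) = (\<Sum>m. \<integral>\<^sup>+\<omega>. ennreal (f m \<omega>) \<partial>M)"
    by (intro nn_integral_suminf) (use int in auto)
  also have "\<dots> = (\<Sum>m. ennreal (expectation (f m)))"
    by (simp add: nn_integral_eq_integral int nonneg)
  also have "\<dots> = ennreal (\<Sum>m. expectation (f m))"
    by (rule suminf_ennreal2) (simp_all add: sb nonneg)
  also have "\<dots> < \<infinity>" by simp
  finally have fin: "(\<integral>\<^sup>+\<omega>. (\<Sum>m. ennreal (f m \<omega>)) \<partial>M) \<noteq> \<infinity>" by simp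
  have "AE \<omega> in M. (\<Sum>m. ennreal (f m \<omega>)) \<noteq> \<infinity>"
    by (intro nn_integral_PInf_AE[OF _ fin]) (use int in auto)
  then show ?thesis
  proof (rule AE_mp, intro AE_I2 impI)
    fix \<omega> assume "(\<Sum>m. ennreal (f m \<omega>)) \<noteq> \<infinity>"
    then have "summable (\<lambda>m. f m \<omega>)"
      by (intro summable_suminf_not_top) (simp_all add: nonneg)
    then show "(\<lambda>m. f m \<omega>) \<longlonglongrightarrow> 0" by (rule summable_LIMSEQ_zero)
  qed
qed

lemma integrable_mult_of_square_integrable:
  fixes f g :: "'a \<Rightarrow> real"
  assumes [measurable]: "f \<in> borel_measurable M" "g \<in> borel_measurable M"
    and "integrable M (\<lambda>\<omega>. (f \<omega>)\<^sup>2)" "integrable M (\<lambda>\<omega>. (g \<omega>)\<^sup>2)"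
  shows "integrable M (\<lambda>\<omega>. f \<omega> * g \<omega>)"
proof (rule Bochner_Integration.integrable_bound)
  show "integrable M (\<lambda>\<omega>. (f \<omega>)\<^sup>2 + (g \<omega>)\<^sup>2)" using assms by simp
  have "\<bar>a * b\<bar> \<le> \<bar>a\<^sup>2 + b\<^sup>2\<bar>" for a b :: real
    using sum_squares_bound[of "\<bar>a\<bar>" "\<bar>b\<bar>"] abs_ge_zero[of "a * b"]
    unfolding abs_mult mult.assoc power2_abs by linarith
  then show "AE \<omega> in M. norm (f \<omega> * g \<omega>) \<le> norm ((f \<omega>)\<^sup>2 + (g \<omega>)\<^sup>2)"
    by simp
qed measurable

locale orthogonal_sequence = prob_space M for M :: "'a measure" +
  fixes Y :: "nat \<Rightarrow> 'a \<Rightarrow> real" and C :: real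
  assumes Y_measurable [measurable]: "\<And>k. Y k \<in> borel_measurable M"
    and Y_square: "\<And>k. integrable M (\<lambda>\<omega>. (Y k \<omega>)\<^sup>2)"
    and Y_orthogonal: "\<And>k l. k < l \<Longrightarrow> expectation (\<lambda>\<omega>. Y k \<omega> * Y l \<omega>) = 0"
    and Y_moment: "\<And>k. expectation (\<lambda>\<omega>. (Y k \<omega>)\<^sup>2) \<le> C"
begin

lemma square_integrable_sum: "finite I \<Longrightarrow> integrable M (\<lambda>\<omega>. (\<Sum>k\<in>I. Y k \<omega>)\<^sup>2)"
  unfolding power2_eq_square sum_product
  by (intro Bochner_Integration.integrable_sum integrable_mult_of_square_integrable Y_measurable Y_square)

lemma second_moment_sum:
  assumes "finite I"
  shows "expectation (\<lambda>\<omega>. (\<Sum>k\<in>I. Y k \<omega>)\<^sup>2) \<le> C * card I"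
proof -
  have int: "integrable M (\<lambda>\<omega>. Y k \<omega> * Y l \<omega>)" for k l
    by (intro integrable_mult_of_square_integrable Y_measurable Y_square)
  have orth: "expectation (\<lambda>\<omega>. Y k \<omega> * Y l \<omega>) = 0" if "k \<noteq> l" for k l
    using Y_orthogonal[of k l] Y_orthogonal[of l k] that by (cases k l rule: linorder_cases) (simp_all add: mult.commute)
  have "expectation (\<lambda>\<omega>. (\<Sum>k\<in>I. Y k \<omega>)\<^sup>2) = (\<Sum>k\<in>I. \<Sum>l\<in>I. expectation (\<lambda>\<omega>. Y k \<omega> * Y l \<omega>))"
    unfolding power2_eq_square sum_product by (simp add: int)
  also have "\<dots> = (\<Sum>k\<in>I. \<Sum>l\<in>I. if l = k then expectation (\<lambda>\<omega>. (Y k \<omega>)\<^sup>2) else 0)"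
    by (intro sum.cong refl) (auto simp: orth power2_eq_square)
  also have "\<dots> = (\<Sum>k\<in>I. expectation (\<lambda>\<omega>. (Y k \<omega>)\<^sup>2))"
    using assms by simp
  also have "\<dots> \<le> (\<Sum>k\<in>I. C)" by (intro sum_mono Y_moment)
  finally show ?thesis by (simp add: mult.commute)
qed

text \<open>
  The second moment of a sum of \<open>m\<close> terms is at most \<open>C m\<close>.  Along the squares, \<open>S (m\<^sup>2) / m\<^sup>2\<close> therefore
  has second moment at most \<open>C / m\<^sup>2\<close>.  Between \<open>m\<^sup>2\<close> and \<open>(m + 1)\<^sup>2\<close> there are \<open>2 m + 1\<close> increments, each
  with second moment at most \<open>C (2 m + 1)\<close>, so that even their sum contributes only \<open>O(1 / m\<^sup>2)\<close> after
  division by \<open>m\<^sup>4\<close>.  Both bounds are summable in \<open>m\<close>.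
\<close>

theorem strong_law: "AE \<omega> in M. (\<lambda>n. (\<Sum>k<n. Y k \<omega>) / n) \<longlonglongrightarrow> 0"
proof -
  define S where "S n \<omega> = (\<Sum>k<n. Y k \<omega>)" for n \<omega>
  define Z where "Z m \<omega> = ((S (m\<^sup>2) \<omega>)\<^sup>2 + (\<Sum>i\<in>{m\<^sup>2..<(Suc m)\<^sup>2}. (S i \<omega> - S (m\<^sup>2) \<omega>)\<^sup>2)) / real m ^ 4"
    for m \<omega>
  have C: "0 \<le> C" by (rule order_trans[OF _ Y_moment[of 0]]) simp
  have diff: "S i \<omega> - S j \<omega> = (\<Sum>k\<in>{j..<i}. Y k \<omega>)" if "j \<le> i" for i j \<omega>
    using that unfolding S_def by (simp add: sum_diff_nat_ivl lessThan_atLeast0)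
  have intS: "integrable M (\<lambda>\<omega>. (S i \<omega>)\<^sup>2)" for i
    unfolding S_def by (intro square_integrable_sum) simp
  have intD: "integrable M (\<lambda>\<omega>. (S i \<omega> - S j \<omega>)\<^sup>2)" if "j \<le> i" for i j
    by (simp add: diff that square_integrable_sum)
  have intZ: "integrable M (Z m)" for m
    unfolding Z_def
    by (intro integrable_divide_zero Bochner_Integration.integrable_add Bochner_Integration.integrable_sum intS intD)
      auto
  have EZ: "expectation (Z m) \<le> 10 * C * (1 / real m ^ 2)" for m
  proof (cases "m = 0")
    case True then show ?thesis by (simp add: Z_def[abs_def])
  next
    case False
    then have m: "real m \<ge> 1" by simp
    have "expectation (Z m) = (expectation (\<lambda>\<omega>. (S (m\<^sup>2) \<omega>)\<^sup>2) +
        (\<Sum>i\<in>{m\<^sup>2..<(Suc m)\<^sup>2}. expectation (\<lambda>\<omega>. (S i \<omega> - S (m\<^sup>2) \<omega>)\<^sup>2))) / real m ^ 4"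
      unfolding Z_def
      by (subst integral_divide_zero, subst Bochner_Integration.integral_add, rule intS,
          rule Bochner_Integration.integrable_sum, rule intD, simp,
          subst Bochner_Integration.integral_sum, rule intD) auto
    also have "\<dots> \<le> (C * m\<^sup>2 + (\<Sum>i\<in>{m\<^sup>2..<(Suc m)\<^sup>2}. C * (2 * m + 1))) / real m ^ 4"
    proof (intro divide_right_mono add_mono sum_mono)
      show "expectation (\<lambda>\<omega>. (S (m\<^sup>2) \<omega>)\<^sup>2) \<le> C * m\<^sup>2"
        using second_moment_sum[of "{..<m\<^sup>2}"] by (simp add: S_def)
      fix i assume i: "i \<in> {m\<^sup>2..<(Suc m)\<^sup>2}"
      have card: "card {m\<^sup>2..<i} \<le> 2 * m + 1"
        using i by (simp add: power2_eq_square) linarith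
      from i have "expectation (\<lambda>\<omega>. (S i \<omega> - S (m\<^sup>2) \<omega>)\<^sup>2) \<le> C * card {m\<^sup>2..<i}"
        using second_moment_sum[of "{m\<^sup>2..<i}"] by (simp add: diff)
      also have "\<dots> \<le> C * (2 * m + 1)"
        using of_nat_mono[OF card, where 'a = real] C by (intro mult_left_mono) simp_all
      finally show "expectation (\<lambda>\<omega>. (S i \<omega> - S (m\<^sup>2) \<omega>)\<^sup>2) \<le> C * (2 * m + 1)" .
    qed simp
    also have "(\<Sum>i\<in>{m\<^sup>2..<(Suc m)\<^sup>2}. C * (2 * m + 1)) = C * (2 * real m + 1)\<^sup>2"
      by (simp add: power2_eq_square algebra_simps)
    also have "(C * m\<^sup>2 + C * (2 * real m + 1)\<^sup>2) \<le> 10 * C * (real m)\<^sup>2"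
    proof -
      have "(2 * real m + 1)\<^sup>2 \<le> (3 * real m)\<^sup>2" using m by (intro power_mono) auto
      then have "C * (2 * real m + 1)\<^sup>2 \<le> C * (9 * (real m)\<^sup>2)"
        using C by (intro mult_left_mono) (auto simp: power_mult_distrib)
      then show ?thesis by (simp add: algebra_simps)
    qed
    then have "(C * m\<^sup>2 + C * (2 * real m + 1)\<^sup>2) / real m ^ 4 \<le> 10 * C * (real m)\<^sup>2 / real m ^ 4"
      by (intro divide_right_mono) auto
    also have "\<dots> = 10 * C * (1 / real m ^ 2)" using m by (simp add: field_simps power2_eq_square power4_eq_xxxx)
    finally show ?thesis by simp
  qed
  have "AE \<omega> in M. (\<lambda>m. Z m \<omega>) \<longlonglongrightarrow> 0"
  proof (rule AE_tendsto_zero_of_summable_expectation[OF intZ _ EZ])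
    show "summable (\<lambda>m. 10 * C * (1 / real m ^ 2))"
      using inverse_power_summable[of 2, where ?'a = real] by (intro summable_mult) (simp add: inverse_eq_divide)
  qed (auto simp: Z_def intro!: divide_nonneg_nonneg add_nonneg_nonneg sum_nonneg)
  then show ?thesis
  proof (rule AE_mp, intro AE_I2 impI)
    fix \<omega> assume Z0: "(\<lambda>m. Z m \<omega>) \<longlonglongrightarrow> 0"
    have fs: "filterlim floor_sqrt at_top sequentially"
      by (rule filterlim_at_top[THEN iffD2])
         (metis (mono_tags) eventually_at_top_linorder floor_sqrt_inverse_power2 mono_floor_sqrt')
    have lim: "(\<lambda>n. 2 * Z (floor_sqrt n) \<omega>) \<longlonglongrightarrow> 0"
      using tendsto_mult_right_zero[OF filterlim_compose[OF Z0 fs], of 2] by simp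
    have "(\<lambda>n. ((\<Sum>k<n. Y k \<omega>) / n)\<^sup>2) \<longlonglongrightarrow> 0"
    proof (rule tendsto_sandwich[OF _ _ tendsto_const lim])
      show "\<forall>\<^sub>F n in sequentially. ((\<Sum>k<n. Y k \<omega>) / n)\<^sup>2 \<le> 2 * Z (floor_sqrt n) \<omega>"
      proof (rule eventually_sequentiallyI)
        fix n :: nat assume n: "1 \<le> n"
        \<comment> \<open>\<open>m\<^sup>2\<close> is the last square up to \<open>n\<close>, so that \<open>Z m\<close> contains the increment from \<open>m\<^sup>2\<close> to \<open>n\<close>.\<close>
        define m where "m = floor_sqrt n"
        have mn: "m\<^sup>2 \<le> n" "n < (Suc m)\<^sup>2"
          unfolding m_def by (simp_all add: Suc_floor_sqrt_power2_gt)
        have m0: "m > 0" using mn n by (cases m) auto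
        define a b where "a = S (m\<^sup>2) \<omega>" and "b = S n \<omega> - S (m\<^sup>2) \<omega>"
        have b: "b\<^sup>2 \<le> (\<Sum>i\<in>{m\<^sup>2..<(Suc m)\<^sup>2}. (S i \<omega> - S (m\<^sup>2) \<omega>)\<^sup>2)"
          unfolding b_def using mn by (intro member_le_sum) auto
        have "(a + b)\<^sup>2 \<le> 2 * (a\<^sup>2 + b\<^sup>2)"
          using sum_squares_bound[of a b] by (simp add: power2_sum)
        also have "\<dots> \<le> 2 * (Z m \<omega> * real m ^ 4)"
          using b m0 by (simp add: Z_def a_def)
        finally have ab: "(a + b)\<^sup>2 \<le> 2 * (Z m \<omega> * real m ^ 4)" .
        have m4: "real m ^ 4 \<le> (real n)\<^sup>2"
        proof -
          have "real (m\<^sup>2) \<le> real n" using mn(1) by (rule of_nat_mono)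
          then have "(real (m\<^sup>2))\<^sup>2 \<le> (real n)\<^sup>2" by (intro power_mono) auto
          then show ?thesis by simp
        qed
        have "((\<Sum>k<n. Y k \<omega>) / n)\<^sup>2 = (a + b)\<^sup>2 / (real n)\<^sup>2"
          by (simp add: a_def b_def S_def power_divide)
        also have "\<dots> \<le> (a + b)\<^sup>2 / real m ^ 4"
          using m4 m0 n by (intro divide_left_mono) auto
        also have "\<dots> \<le> 2 * Z m \<omega>"
          using ab m0 by (simp add: field_simps)
        finally show "((\<Sum>k<n. Y k \<omega>) / n)\<^sup>2 \<le> 2 * Z (floor_sqrt n) \<omega>" by (simp add: m_def)
      qed
    qed simp
    then show "(\<lambda>n. (\<Sum>k<n. Y k \<omega>) / n) \<longlonglongrightarrow> 0"
      by (rule power_tendsto_0_iff[THEN iffD1, rotated]) simp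
  qed
qed

end

section \<open>Square-integrable independent noise\<close>

locale iid_noise = prob_space M for M :: "'a measure" +
  fixes V :: "nat \<Rightarrow> 'a \<Rightarrow> real" and \<sigma> :: real
  assumes indep: "indep_vars (\<lambda>_. borel) V {1..}"
    and ident: "\<And>n. 1 \<le> n \<Longrightarrow> distr M borel (V n) = distr M borel (V 1)"
    and square_integrable: "\<And>n. 1 \<le> n \<Longrightarrow> integrable M (\<lambda>\<omega>. (V n \<omega>)\<^sup>2)"
    and centred: "\<And>n. 1 \<le> n \<Longrightarrow> expectation (V n) = 0"
    and variance: "\<And>n. 1 \<le> n \<Longrightarrow> expectation (\<lambda>\<omega>. (V n \<omega>)\<^sup>2) = \<sigma>\<^sup>2"
    and nondegenerate: "0 < \<sigma>\<^sup>2"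
begin

lemma V_measurable: "1 \<le> n \<Longrightarrow> V n \<in> borel_measurable M"
  using indep unfolding indep_vars_def by auto

lemma expectation_ident:
  fixes g :: "real \<Rightarrow> real"
  assumes [measurable]: "g \<in> borel_measurable borel" and n: "1 \<le> n"
  shows "expectation (\<lambda>\<omega>. g (V n \<omega>)) = expectation (\<lambda>\<omega>. g (V 1 \<omega>))"
proof -
  have "expectation (\<lambda>\<omega>. g (V n \<omega>)) = (\<integral>x. g x \<partial>distr M borel (V n))"
    using V_measurable[OF n] by (simp add: integral_distr)
  also have "\<dots> = expectation (\<lambda>\<omega>. g (V 1 \<omega>))"
    using V_measurable[of 1] by (simp add: ident[OF n] integral_distr)
  finally show ?thesis .
qed

lemma
  fixes g :: "nat \<Rightarrow> real \<Rightarrow> real"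
  assumes I: "finite I" "I \<subseteq> {1..}"
    and g: "\<And>i. i \<in> I \<Longrightarrow> g i \<in> borel_measurable borel"
      "\<And>i. i \<in> I \<Longrightarrow> integrable M (\<lambda>\<omega>. g i (V i \<omega>))"
  shows expectation_prod: "expectation (\<lambda>\<omega>. \<Prod>i\<in>I. g i (V i \<omega>)) = (\<Prod>i\<in>I. expectation (\<lambda>\<omega>. g i (V i \<omega>)))"
    and integrable_prod: "integrable M (\<lambda>\<omega>. \<Prod>i\<in>I. g i (V i \<omega>))"
proof -
  have ind: "indep_vars (\<lambda>_. borel) (\<lambda>i \<omega>. g i (V i \<omega>)) I"
    using indep_vars_subset[OF indep I(2)] g(1) by (rule indep_vars_compose2)
  show "expectation (\<lambda>\<omega>. \<Prod>i\<in>I. g i (V i \<omega>)) = (\<Prod>i\<in>I. expectation (\<lambda>\<omega>. g i (V i \<omega>)))"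
    by (rule indep_vars_lebesgue_integral[OF I(1) ind g(2)])
  show "integrable M (\<lambda>\<omega>. \<Prod>i\<in>I. g i (V i \<omega>))"
    by (rule indep_vars_integrable[OF I(1) ind g(2)])
qed

lemma integrable_power:
  assumes "1 \<le> n" "e \<le> 2"
  shows "integrable M (\<lambda>\<omega>. V n \<omega> ^ e)"
proof -
  consider "e = 0" | "e = 1" | "e = 2" using assms(2) by linarith
  then show ?thesis
    using square_integrable_imp_integrable[OF V_measurable square_integrable] square_integrable assms(1)
    by cases auto
qed

lemma expectation_power_prod_eq_0:
  assumes "finite I" "I \<subseteq> {1..}" "\<And>i. i \<in> I \<Longrightarrow> e i \<le> 2" "i \<in> I" "e i = 1"
  shows "expectation (\<lambda>\<omega>. \<Prod>i\<in>I. V i \<omega> ^ e i) = 0"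
proof -
  have "expectation (\<lambda>\<omega>. \<Prod>i\<in>I. V i \<omega> ^ e i) = (\<Prod>i\<in>I. expectation (\<lambda>\<omega>. V i \<omega> ^ e i))"
    using assms by (intro expectation_prod integrable_power) auto
  also have "\<dots> = 0"
    using assms centred[of i] by (intro prod_zero) (auto intro!: bexI[of _ i])
  finally show ?thesis .
qed

text \<open>
  The products \<open>V (k + j) V k\<close> are not independent of one another, but they are orthogonal: in the
  product of two of them the latest factor \<open>V\<close> appears once and is independent of the others.
\<close>

lemma AE_lag_sum_average:
  assumes j: "1 \<le> j"
  shows "AE \<omega> in M. (\<lambda>n. lag_sum (\<lambda>k. V k \<omega>) (\<lambda>k. V k \<omega>) j n / n) \<longlonglongrightarrow> 0"
proof -
  define Y where "Y k \<omega> = V (Suc k + j) \<omega> * V (Suc k) \<omega>" for k \<omega>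
  have pair: "(\<Prod>i\<in>{Suc k, Suc k + j}. V i \<omega> ^ 2) = (Y k \<omega>)\<^sup>2" for k \<omega>
    using j by (simp add: Y_def power_mult_distrib)
  interpret orthogonal_sequence M Y "\<sigma>\<^sup>2 * \<sigma>\<^sup>2"
  proof
    show "Y k \<in> borel_measurable M" for k
      unfolding Y_def by (intro borel_measurable_times V_measurable) auto
    show "integrable M (\<lambda>\<omega>. (Y k \<omega>)\<^sup>2)" for k
      unfolding pair[symmetric] by (rule integrable_prod) (auto intro: integrable_power)
    have "expectation (\<lambda>\<omega>. (Y k \<omega>)\<^sup>2) = \<sigma>\<^sup>2 * \<sigma>\<^sup>2" for k
      unfolding pair[symmetric] using j
      by (subst expectation_prod) (auto intro: integrable_power simp: variance)
    then show "expectation (\<lambda>\<omega>. (Y k \<omega>)\<^sup>2) \<le> \<sigma>\<^sup>2 * \<sigma>\<^sup>2" for k by simp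
    fix k l :: nat assume kl: "k < l"
    show "expectation (\<lambda>\<omega>. Y k \<omega> * Y l \<omega>) = 0"
    \<comment> \<open>If \<open>l = k + j\<close>, the two products share the factor \<open>V (Suc l)\<close>, which then occurs squared.\<close>
    proof (cases "l = k + j")
      case True
      have "Y k \<omega> * Y l \<omega> = (\<Prod>i\<in>{Suc k, Suc l, Suc l + j}. V i \<omega> ^ (if i = Suc l then 2 else 1))" for \<omega>
        using j by (simp add: Y_def True power2_eq_square)
      then show ?thesis
        using j kl by (simp only:) (rule expectation_power_prod_eq_0[where i = "Suc l + j"]; auto)
    next
      case False
      have "Y k \<omega> * Y l \<omega> = (\<Prod>i\<in>{Suc k, Suc k + j, Suc l, Suc l + j}. V i \<omega> ^ 1)" for \<omega>
        using j kl False by (simp add: Y_def)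
      then show ?thesis
        using j kl by (simp only:) (rule expectation_power_prod_eq_0[where i = "Suc l + j"]; auto)
    qed
  qed
  have "lag_sum (\<lambda>k. V k \<omega>) (\<lambda>k. V k \<omega>) j (n + j) = (\<Sum>k<n. Y k \<omega>)" for n \<omega>
    by (induction n) (simp_all add: lag_sum_Suc Y_def, simp add: lag_sum_def)
  note lag = this
  show ?thesis
    using strong_law
  proof (rule AE_mp, intro AE_I2 impI)
    fix \<omega> assume lim: "(\<lambda>n. (\<Sum>k<n. Y k \<omega>) / real n) \<longlonglongrightarrow> 0"
    have "(\<lambda>n. \<bar>(\<Sum>k<n. Y k \<omega>) / real n\<bar>) \<longlonglongrightarrow> 0"
      using lim by (rule tendsto_rabs_zero)
    then have "(\<lambda>n. lag_sum (\<lambda>k. V k \<omega>) (\<lambda>k. V k \<omega>) j (n + j) / real (n + j)) \<longlonglongrightarrow> 0"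
    proof (rule Lim_null_comparison[rotated])
      show "\<forall>\<^sub>F n in sequentially. norm (lag_sum (\<lambda>k. V k \<omega>) (\<lambda>k. V k \<omega>) j (n + j) / real (n + j))
          \<le> \<bar>(\<Sum>k<n. Y k \<omega>) / real n\<bar>"
        using eventually_gt_at_top[of 0]
        by eventually_elim (auto simp: lag abs_divide intro!: divide_left_mono)
    qed
    then show "(\<lambda>n. lag_sum (\<lambda>k. V k \<omega>) (\<lambda>k. V k \<omega>) j n / real n) \<longlonglongrightarrow> 0"
      by (rule LIMSEQ_offset)
  qed
qed

text \<open>
  Truncating the squares at \<open>1\<close> gives bounded variables, to which the law for orthogonal sequences
  applies after centring.  Their mean is positive because the noise is not degenerate.
\<close>

lemma AE_energy_linear_growth:
  "\<exists>c::real>0. AE \<omega> in M. \<forall>\<^sub>F n in sequentially. c * n \<le> energy (\<lambda>k. V k \<omega>) n"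
proof -
  define g :: "real \<Rightarrow> real" where "g x = min (x\<^sup>2) 1" for x
  have g_meas [measurable]: "g \<in> borel_measurable borel" unfolding g_def by measurable
  have g01: "0 \<le> g x" "g x \<le> 1" for x by (auto simp: g_def)
  define c where "c = expectation (\<lambda>\<omega>. g (V 1 \<omega>))"
  have int: "integrable M (\<lambda>\<omega>. g (V n \<omega>))" if "1 \<le> n" for n
    using V_measurable[OF that] g01 by (intro integrable_const_bound[of _ 1]) auto
  have c0: "0 \<le> c" unfolding c_def using g01 by simp
  have c1: "c \<le> 1"
    unfolding c_def using integral_mono[OF int[of 1], of "\<lambda>_. 1"] g01 by (simp add: prob_space)
  have "c \<noteq> 0"
  proof
    assume "c = 0"
    then have "AE \<omega> in M. g (V 1 \<omega>) = 0"
      using integral_nonneg_eq_0_iff_AE[OF int[of 1]] g01 by (simp add: c_def)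
    then have "AE \<omega> in M. (V 1 \<omega>)\<^sup>2 = 0"
      by eventually_elim (auto simp: g_def min_def split: if_splits)
    then have "expectation (\<lambda>\<omega>. (V 1 \<omega>)\<^sup>2) = 0"
      by (rule integral_eq_zero_AE)
    then show False using variance[of 1] nondegenerate by simp
  qed
  with c0 have c: "0 < c" by simp
  define Y where "Y k \<omega> = g (V (Suc k) \<omega>) - c" for k \<omega>
  have Y1: "(Y k \<omega>)\<^sup>2 \<le> 1" for k \<omega>
  proof -
    have "\<bar>Y k \<omega>\<bar> \<le> 1" using g01[of "V (Suc k) \<omega>"] c0 c1 by (auto simp: Y_def)
    then show ?thesis by (simp add: abs_square_le_1)
  qed
  have mean: "expectation (Y k) = 0" for k
    unfolding Y_def using int[of "Suc k"] expectation_ident[OF g_meas, of "Suc k"]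
    by (simp add: prob_space c_def)
  have Y_meas: "Y k \<in> borel_measurable M" for k
    unfolding Y_def using V_measurable[of "Suc k"] by simp
  have Y_sq: "integrable M (\<lambda>\<omega>. (Y k \<omega>)\<^sup>2)" for k
    using Y1 Y_meas by (intro integrable_const_bound[of _ 1]) auto
  interpret orthogonal_sequence M Y 1
  proof
    show "expectation (\<lambda>\<omega>. (Y k \<omega>)\<^sup>2) \<le> 1" for k
      using integral_mono[OF Y_sq, of "\<lambda>_. 1"] Y1 by (simp add: prob_space)
    fix k l :: nat assume kl: "k < l"
    have "expectation (\<lambda>\<omega>. \<Prod>i\<in>{Suc k, Suc l}. g (V i \<omega>) - c)
        = (\<Prod>i\<in>{Suc k, Suc l}. expectation (\<lambda>\<omega>. g (V i \<omega>) - c))"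
      by (rule expectation_prod[where g = "\<lambda>_ x. g x - c"]) (auto intro!: Bochner_Integration.integrable_diff int)
    then show "expectation (\<lambda>\<omega>. Y k \<omega> * Y l \<omega>) = 0"
      using kl mean[of k] by (simp add: Y_def[abs_def])
  qed (fact Y_meas Y_sq)+
  have "AE \<omega> in M. \<forall>\<^sub>F n in sequentially. c / 2 * n \<le> energy (\<lambda>k. V k \<omega>) n"
    using strong_law
  proof (rule AE_mp, intro AE_I2 impI)
    fix \<omega> assume "(\<lambda>n. (\<Sum>k<n. Y k \<omega>) / real n) \<longlonglongrightarrow> 0"
    then have "\<forall>\<^sub>F n in sequentially. - (c / 2) < (\<Sum>k<n. Y k \<omega>) / real n"
      using c by (intro order_tendstoD) auto
    then show "\<forall>\<^sub>F n in sequentially. c / 2 * n \<le> energy (\<lambda>k. V k \<omega>) n"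
      using eventually_gt_at_top[of 0]
    proof eventually_elim
      case (elim n)
      have "(\<Sum>k<n. Y k \<omega>) + c * n \<le> energy (\<lambda>k. V k \<omega>) n" for n
      proof (induction n)
        case (Suc n)
        have "Y n \<omega> + c \<le> (V (Suc n) \<omega>)\<^sup>2" by (simp add: Y_def g_def)
        with Suc show ?case by (simp add: lag_sum_Suc power2_eq_square algebra_simps)
      qed simp
      from this[of n] show ?case using elim by (simp add: field_simps)
    qed
  qed
  with c show ?thesis by (intro exI[of _ "c / 2"]) auto
qed

text \<open>
  Borel--Cantelli: as the variables are identically distributed, the probabilities that
  \<open>(V n)\<^sup>2 > d n\<close> add up to the expected number of \<open>n \<ge> 1\<close> with \<open>d n < (V 1)\<^sup>2\<close>, which is at most the
  expectation of \<open>(V 1)\<^sup>2 / d\<close>.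
\<close>

lemma AE_eventually_square_le:
  fixes d :: real
  assumes d: "0 < d"
  shows "AE \<omega> in M. \<forall>\<^sub>F n in sequentially. (V (Suc n) \<omega>)\<^sup>2 \<le> d * Suc n"
proof -
  define A where "A n = {\<omega> \<in> space M. d * Suc n < (V (Suc n) \<omega>)\<^sup>2}" for n
  define h :: "nat \<Rightarrow> real \<Rightarrow> real" where "h n x = (if d * Suc n < x\<^sup>2 then 1 else 0)"
    for n :: nat and x :: real
  have h_meas [measurable]: "h n \<in> borel_measurable borel" for n unfolding h_def by measurable
  have A_meas: "A n \<in> sets M" for n
    unfolding A_def using V_measurable[of "Suc n"] by measurable
  have int: "integrable M (\<lambda>\<omega>. h n (V m \<omega>))" if "1 \<le> m" for n m
    using V_measurable[OF that] by (intro integrable_const_bound[of _ 1]) (auto simp: h_def)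
  have prob_A: "prob (A n) = expectation (\<lambda>\<omega>. h n (V 1 \<omega>))" for n
  proof -
    have "prob (A n) = expectation (indicator (A n))" using A_meas[of n] by simp
    also have "\<dots> = expectation (\<lambda>\<omega>. h n (V (Suc n) \<omega>))"
      by (intro Bochner_Integration.integral_cong) (auto simp: A_def h_def)
    finally show ?thesis using expectation_ident[OF h_meas, of "Suc n"] by simp
  qed
  have count: "(\<Sum>n<N. h n x) \<le> x\<^sup>2 / d" for N x
  proof -
    \<comment> \<open>The minimum with \<open>N\<close> strengthens the bound so that induction on \<open>N\<close> goes through.\<close>
    have "(\<Sum>n<N. h n x) \<le> min (x\<^sup>2 / d) N"
    proof (induction N)
      case (Suc N)
      have "d * Suc N < x\<^sup>2 \<longleftrightarrow> Suc N < x\<^sup>2 / d" using d by (simp add: field_simps)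
      with Suc show ?case by (auto simp: h_def min_def split: if_splits)
    qed (use d in simp)
    then show ?thesis by simp
  qed
  have "summable (\<lambda>n. prob (A n))"
  proof (rule summableI_nonneg_bounded)
    fix N
    have "(\<Sum>n<N. prob (A n)) = expectation (\<lambda>\<omega>. \<Sum>n<N. h n (V 1 \<omega>))"
      unfolding prob_A using int[of 1] by simp
    also have "\<dots> \<le> expectation (\<lambda>\<omega>. (V 1 \<omega>)\<^sup>2 / d)"
      using int[of 1] square_integrable[of 1] count by (intro integral_mono) auto
    finally show "(\<Sum>n<N. prob (A n)) \<le> expectation (\<lambda>\<omega>. (V 1 \<omega>)\<^sup>2 / d)" .
  qed simp
  then have "AE \<omega> in M. \<forall>\<^sub>F n in sequentially. \<omega> \<in> space M - A n"
    by (intro borel_cantelli_AE1 A_meas) (simp_all add: emeasure_eq_measure)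
  then show ?thesis
    by eventually_elim (auto simp: A_def not_less elim: eventually_mono)
qed

lemma AE_square_average: "AE \<omega> in M. (\<lambda>n. (V n \<omega>)\<^sup>2 / n) \<longlonglongrightarrow> 0"
proof -
  have "AE \<omega> in M. \<forall>m::nat. \<forall>\<^sub>F n in sequentially. (V (Suc n) \<omega>)\<^sup>2 \<le> inverse (Suc m) * Suc n"
    unfolding AE_all_countable by (intro allI AE_eventually_square_le) simp
  then show ?thesis
  proof (rule AE_mp, intro AE_I2 impI)
    fix \<omega>
    assume V: "\<forall>m::nat. \<forall>\<^sub>F n in sequentially. (V (Suc n) \<omega>)\<^sup>2 \<le> inverse (Suc m) * Suc n"
    have "(\<lambda>n. (V (Suc n) \<omega>)\<^sup>2 / Suc n) \<longlonglongrightarrow> 0"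
    proof (rule tendstoI)
      fix e :: real assume "0 < e"
      then obtain m where m: "inverse (real (Suc m)) < e" using reals_Archimedean by blast
      from V have "\<forall>\<^sub>F n in sequentially. (V (Suc n) \<omega>)\<^sup>2 \<le> inverse (Suc m) * Suc n" by blast
      then show "\<forall>\<^sub>F n in sequentially. dist ((V (Suc n) \<omega>)\<^sup>2 / Suc n) 0 < e"
      proof eventually_elim
        case (elim n)
        then have "(V (Suc n) \<omega>)\<^sup>2 / Suc n \<le> inverse (Suc m)"
          by (subst pos_divide_le_eq) auto
        then show ?case using m by (simp add: dist_real_def del: of_nat_Suc)
      qed
    qed
    then show "(\<lambda>n. (V n \<omega>)\<^sup>2 / n) \<longlonglongrightarrow> 0" by (rule LIMSEQ_imp_Suc)
  qed
qed

proposition AE_predetermined: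
  "AE \<omega> in M. predetermined (\<lambda>k. V k \<omega>) (\<lambda>k. V k \<omega>)
    \<and> filterlim (energy (\<lambda>k. V k \<omega>)) at_top sequentially"
proof -
  obtain c :: real where c: "0 < c"
    and growth: "AE \<omega> in M. \<forall>\<^sub>F n in sequentially. c * n \<le> energy (\<lambda>k. V k \<omega>) n"
    using AE_energy_linear_growth by blast
  have "AE \<omega> in M. \<forall>j. 1 \<le> j \<longrightarrow>
      (\<lambda>n. lag_sum (\<lambda>k. V k \<omega>) (\<lambda>k. V k \<omega>) j n / n) \<longlonglongrightarrow> 0"
    unfolding AE_all_countable by (intro allI AE_impI AE_lag_sum_average)
  with growth AE_square_average show ?thesis
  proof eventually_elim
    case (elim \<omega>)
    define v where "v = (\<lambda>k. V k \<omega>)"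
    have transfer: "(\<lambda>n. f n / energy v n) \<longlonglongrightarrow> 0" if f: "(\<lambda>n. f n / real n) \<longlonglongrightarrow> 0" for f
    proof (rule Lim_null_comparison)
      show "(\<lambda>n. \<bar>f n / real n\<bar> * inverse c) \<longlonglongrightarrow> 0"
        using f by (intro tendsto_mult_left_zero tendsto_rabs_zero)
      show "\<forall>\<^sub>F n in sequentially. norm (f n / energy v n) \<le> \<bar>f n / real n\<bar> * inverse c"
        using elim(1) eventually_gt_at_top[of 0]
      proof eventually_elim
        case (elim n)
        have "0 < c * n" using c elim by simp
        then have "\<bar>f n\<bar> / energy v n \<le> \<bar>f n\<bar> / (c * n)"
          using elim by (intro divide_left_mono) (auto simp: v_def)
        then show ?case
          using elim c by (simp add: abs_divide energy_nonneg field_simps)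
      qed
    qed
    have "filterlim (\<lambda>n. c * real n) at_top sequentially"
      using c by (intro filterlim_tendsto_pos_mult_at_top[OF tendsto_const] filterlim_real_sequentially)
    then have "filterlim (energy v) at_top sequentially"
      by (rule filterlim_at_top_mono) (use elim(1) in \<open>simp add: v_def\<close>)
    moreover have "predetermined v v"
      unfolding predetermined_def
    proof (intro conjI allI impI transfer exI[of _ 1])
      show "(\<lambda>n. (v n)\<^sup>2 / real n) \<longlonglongrightarrow> 0" using elim(2) by (simp add: v_def)
      show "(\<lambda>n. lag_sum v v j n / real n) \<longlonglongrightarrow> 0" if "1 \<le> j" for j
        using elim(3) that by (simp add: v_def)
    qed simp
    ultimately show ?case by (simp add: v_def)
  qed
qed

end

section \<open>Almost sure limit of the serial correlation estimator\<close>

theorem theorem3p1: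
  fixes M :: "'a measure"
    and V X \<epsilon> :: "nat \<Rightarrow> 'a \<Rightarrow> real"
    and \<theta> \<rho> \<sigma> :: real
  assumes "prob_space M"
    and "\<bar>\<theta>\<bar> < 1" and "\<bar>\<rho>\<bar> < 1"
    and "prob_space.indep_vars M (\<lambda>_. borel) V {1..}"
    and "\<And>n. n \<ge> 1 \<Longrightarrow> distr M borel (V n) = distr M borel (V 1)"
    and "\<And>n. n \<ge> 1 \<Longrightarrow> integrable M (\<lambda>\<omega>. (V n \<omega>)\<^sup>2)"
    and "\<And>n. n \<ge> 1 \<Longrightarrow> prob_space.expectation M (V n) = 0"
    and "\<And>n. n \<ge> 1 \<Longrightarrow> prob_space.variance M (V n) = \<sigma>\<^sup>2"
    and "\<sigma>\<^sup>2 > 0"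
    and "X 0 \<in> borel_measurable M" and "\<epsilon> 0 \<in> borel_measurable M"
    and "\<And>n \<omega>. n \<ge> 1 \<Longrightarrow> \<omega> \<in> space M \<Longrightarrow> X n \<omega> = \<theta> * X (n - 1) \<omega> + \<epsilon> n \<omega>"
    and "\<And>n \<omega>. n \<ge> 1 \<Longrightarrow> \<omega> \<in> space M \<Longrightarrow> \<epsilon> n \<omega> = \<rho> * \<epsilon> (n - 1) \<omega> + V n \<omega>"
  shows "AE \<omega> in M. (\<lambda>n. rho_hat (\<lambda>k. X k \<omega>) n) \<longlonglongrightarrow> \<theta> * \<rho> * (\<theta> + \<rho>) / (1 + \<theta> * \<rho>)"
proof -
  interpret prob_space M by fact
  interpret iid_noise M V \<sigma>
  proof
    show "expectation (\<lambda>\<omega>. (V n \<omega>)\<^sup>2) = \<sigma>\<^sup>2" if "1 \<le> n" for n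
      using assms(7,8)[OF that] by simp
  qed (fact assms(4-7,9))+
  show ?thesis
    using AE_predetermined
  proof (rule AE_mp, intro AE_I2 impI)
    fix \<omega> assume \<omega>: "\<omega> \<in> space M"
      and V: "predetermined (\<lambda>k. V k \<omega>) (\<lambda>k. V k \<omega>)
        \<and> filterlim (energy (\<lambda>k. V k \<omega>)) at_top sequentially"
    show "(\<lambda>n. rho_hat (\<lambda>k. X k \<omega>) n) \<longlonglongrightarrow> \<theta> * \<rho> * (\<theta> + \<rho>) / (1 + \<theta> * \<rho>)"
    proof (rule rho_hat_tendsto[where v = "\<lambda>k. V k \<omega>" and \<epsilon> = "\<lambda>k. \<epsilon> k \<omega>"])
      show "X (Suc k) \<omega> = \<theta> * X k \<omega> + \<epsilon> (Suc k) \<omega>" for k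
        using assms(12)[of "Suc k" \<omega>] \<omega> by simp
      show "\<epsilon> (Suc k) \<omega> = \<rho> * \<epsilon> k \<omega> + V (Suc k) \<omega>" for k
        using assms(13)[of "Suc k" \<omega>] \<omega> by simp
    qed (use assms(2,3) V in auto)
  qed
qed

end
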